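(* Let $\{a_n\}_{n\geq 0}$ be the Narayana sequence, defined by $a_0=0$, $a_1=a_2=1$ and $a_n=a_{n-1}+a_{n-3}$ for $n\geq 3$. The only solutions of the equation $a_n=m!$ in positive integers $n$ and $m$ are $(n,m)\in\{(1,1),(2,1),(3,1),(4,2),(7,3)\}$. *)

theory Defs
  imports Main
begin

fun narayana :: "nat \<Rightarrow> nat" where
  "narayana 0 = 0"
| "narayana (Suc 0) = 1"
| "narayana (Suc (Suc 0)) = 1"
| "narayana (Suc (Suc (Suc n))) = narayana (Suc (Suc n)) + narayana n"

end

theory Submission
  imports Defs "HOL-Number_Theory.Cong"
begin

text \<open>
  A factorial is divisible by a large power of 2, while \<open>a\<^sub>n\<close> is not. Extended to negative
  indices, the sequence vanishes at \<open>0\<close>, \<open>-1\<close>, \<open>-3\<close>, \<open>-8\<close>, and modulo 48 it has period 56,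
  vanishing only in the residue classes of these four indices. (Modulo 16 alone there is one further
  class; the factor 3 excludes it.) If \<open>n\<close> is \<open>56 * 2 ^ i * u\<close>, \<open>u\<close> odd, away from
  one of these zeros, then \<open>2 ^ (i + 7)\<close> does not divide \<open>a\<^sub>n\<close>, so the 2-part of \<open>a\<^sub>n\<close> is
  \<open>O(n)\<close>. Since \<open>a\<^sub>n\<close> grows exponentially, \<open>a\<^sub>n = m!\<close> forces \<open>n = O(m\<^sup>2)\<close>, which is
  incompatible with the 2-part of \<open>m!\<close> once \<open>m \<ge> 12\<close>.
\<close>

text \<open>The Narayana sequence started at index \<open>-8\<close>, its smallest zero among the four above.\<close>

fun narayana_ext :: "nat \<Rightarrow> int" where
  "narayana_ext 0 = 0"
| "narayana_ext (Suc 0) = -2"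
| "narayana_ext (Suc (Suc 0)) = 1"
| "narayana_ext (Suc (Suc (Suc n))) = narayana_ext (Suc (Suc n)) + narayana_ext n"

section \<open>Recurrences and tables of values\<close>

lemma narayana_ext_initial: "narayana_ext 0 = 0" "narayana_ext 1 = -2" "narayana_ext 2 = 1"
  by (simp_all add: numeral_2_eq_2)

lemma narayana_ext_add3: "narayana_ext (n + 3) = narayana_ext (n + 2) + narayana_ext n"
  by (simp add: numeral_eq_Suc)

lemma narayana_ext_add4:
  "narayana_ext (n + 4) = narayana_ext (n + 2) + narayana_ext (n + 1) + narayana_ext n"
  by (simp add: numeral_eq_Suc)

lemma narayana_ext_add8: "narayana_ext (n + 8) = int (narayana n)"
  by (induction n rule: narayana.induct) (simp_all add: numeral_eq_Suc)

text \<open>Carrying three successive values makes evaluation linear in the length, while the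
  recursion of \<open>narayana_ext\<close> branches exponentially.\<close>

fun narayana_table :: "nat \<Rightarrow> nat \<Rightarrow> int \<Rightarrow> int \<Rightarrow> int \<Rightarrow> (nat \<times> int) list" where
  "narayana_table 0 n x y z = []"
| "narayana_table (Suc k) n x y z = (n, x) # narayana_table k (Suc n) y z (z + x)"

lemma narayana_table_eq:
  "narayana_table k n (narayana_ext n) (narayana_ext (n + 1)) (narayana_ext (n + 2))
     = map (\<lambda>i. (i, narayana_ext i)) [n..<n + k]"
proof (induction k arbitrary: n)
  case (Suc k)
  from Suc[of "Suc n"] show ?case
    by (simp add: upt_conv_Cons del: upt_Suc)
qed simp

section \<open>The shift by 56 and the zeros modulo 48\<close>

text \<open>The coefficients are those of x^56 reduced modulo x^3 - x^2 - 1, reached from x^7 by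
  three squarings. They are 1, 0, 0 modulo 48, whence the period.\<close>

lemma narayana_ext_add56:
  "narayana_ext (n + 56)
     = 384377665 * narayana_ext n + 262271568 * narayana_ext (n + 1) + 563332848 * narayana_ext (n + 2)"
proof -
  note R = narayana_ext_add3
  have 7: "narayana_ext (n + 7) = 3 * narayana_ext n + 2 * narayana_ext (n + 1) + 4 * narayana_ext (n + 2)" for n
    by (simp add: numeral_eq_Suc)
  have 14: "narayana_ext (n + 14) = 41 * narayana_ext n + 28 * narayana_ext (n + 1) + 60 * narayana_ext (n + 2)" for n
    using 7[of "n + 7"] 7[of n] 7[of "n + 1"] 7[of "n + 2"] R[of n] narayana_ext_add4[of n]
    by (simp add: add.assoc)
  have 28: "narayana_ext (n + 28) = 8641 * narayana_ext n + 5896 * narayana_ext (n + 1) + 12664 * narayana_ext (n + 2)" for n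
    using 14[of "n + 14"] 14[of n] 14[of "n + 1"] 14[of "n + 2"] R[of n] narayana_ext_add4[of n]
    by (simp add: add.assoc)
  show ?thesis
    using 28[of "n + 28"] 28[of n] 28[of "n + 1"] 28[of "n + 2"] R[of n] narayana_ext_add4[of n]
    by (simp add: add.assoc)
qed

lemma narayana_ext_mod_48: "[narayana_ext n = narayana_ext (n mod 56)] (mod 48)"
proof -
  have step: "[narayana_ext (n + 56) = narayana_ext n] (mod 48)" for n
  proof -
    have "narayana_ext (n + 56) - narayana_ext n
        = 48 * (8007868 * narayana_ext n + 5463991 * narayana_ext (n + 1) + 11736101 * narayana_ext (n + 2))"
      by (simp add: narayana_ext_add56)
    thus ?thesis
      by (metis cong_iff_dvd_diff dvd_triv_left)
  qed
  have "[narayana_ext (r + 56 * q) = narayana_ext r] (mod 48)" for r q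
  proof (induction q)
    case (Suc q)
    have "[narayana_ext (r + 56 * q + 56) = narayana_ext r] (mod 48)"
      using step Suc cong_trans by blast
    thus ?case by (simp add: add.assoc add.commute[of 56])
  qed simp
  from this[of "n mod 56" "n div 56"] show ?thesis by simp
qed

text \<open>A check of one full period suffices. The residues 0, 5, 7, 8 are the original indices
  -8, -3, -1, 0.\<close>

lemma narayana_ext_dvd_48:
  assumes "48 dvd narayana_ext n"
  shows "n mod 56 \<in> {0, 5, 7, 8}"
proof -
  have "list_all (\<lambda>(i, x). 48 dvd x \<longrightarrow> i = 0 \<or> i = 5 \<or> i = 7 \<or> i = 8)
          (narayana_table 56 0 0 (-2) 1)"
    by code_simp
  moreover have "narayana_table 56 0 0 (-2) 1 = map (\<lambda>i. (i, narayana_ext i)) [0..<56]"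
    using narayana_table_eq[of 56 0] by (simp only: add_0 narayana_ext_initial)
  ultimately have "\<forall>i<56. 48 dvd narayana_ext i \<longrightarrow> i = 0 \<or> i = 5 \<or> i = 7 \<or> i = 8"
    by (simp add: list_all_iff)
  moreover have "48 dvd narayana_ext (n mod 56)"
    using assms narayana_ext_mod_48 cong_dvd_iff by blast
  ultimately show ?thesis by simp
qed

text \<open>Squaring \<open>x ^ T = 1 + 2 ^ s * (\<alpha> + \<beta> * x + \<gamma> * x\<^sup>2)\<close> modulo \<open>x ^ 3 - x\<^sup>2 - 1\<close> changes
  \<open>\<alpha>\<close>, \<open>\<beta>\<close>, \<open>\<gamma>\<close> only by multiples of \<open>2 ^ (s - 1)\<close>, so they stay fixed modulo 8.\<close>

lemma narayana_ext_add_pow2: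
  "\<exists>\<alpha> \<beta> \<gamma>. [\<alpha> = 4] (mod 8) \<and> [\<beta> = 5] (mod 8) \<and> [\<gamma> = 7] (mod 8) \<and>
     (\<forall>n. narayana_ext (n + 56 * 2 ^ i) = narayana_ext n + 2 ^ (i + 4) *
        (\<alpha> * narayana_ext n + \<beta> * narayana_ext (n + 1) + \<gamma> * narayana_ext (n + 2)))"
proof (induction i)
  case 0
  show ?case
    \<comment> \<open>The coefficients of \<open>narayana_ext_add56\<close>, less 1 in the first,
      divided by 16.\<close>
    by (intro exI[of _ 24023604] exI[of _ 16391973] exI[of _ 35208303])
      (simp add: narayana_ext_add56 cong_def)
next
  case (Suc i)
  then obtain \<alpha> \<beta> \<gamma> :: int where
    m: "[\<alpha> = 4] (mod 8)" "[\<beta> = 5] (mod 8)" "[\<gamma> = 7] (mod 8)" and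
    eq: "\<And>n. narayana_ext (n + 56 * 2 ^ i) = narayana_ext n + 2 ^ (i + 4) *
        (\<alpha> * narayana_ext n + \<beta> * narayana_ext (n + 1) + \<gamma> * narayana_ext (n + 2))"
    by blast
  define P :: int where "P = 2 ^ i"
  have pw: "(2::int) ^ (i + 4) = 16 * P" "(2::int) ^ (Suc i + 4) = 32 * P"
    by (simp_all add: P_def power_add)
  have lift: "[x + 8 * y = z] (mod 8)" if "[x = z] (mod 8)" for x y z :: int
    using that by (simp add: cong_def)
  \<comment> \<open>With A = \<alpha> + \<beta> x + \<gamma> x^2, (1 + 16 P A)^2 = 1 + 32 P (A + 8 P
    A^2). The factors of P are the coefficients of A^2, reduced by x^3 = x^2 + 1 and x^4 = x^2 + x +
    1.\<close>
  define \<alpha>' where "\<alpha>' = \<alpha> + 8 * (P * (\<alpha>\<^sup>2 + 2 * \<beta> * \<gamma> + \<gamma>\<^sup>2))"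
  define \<beta>' where "\<beta>' = \<beta> + 8 * (P * (2 * \<alpha> * \<beta> + \<gamma>\<^sup>2))"
  define \<gamma>' where "\<gamma>' = \<gamma> + 8 * (P * (\<beta>\<^sup>2 + 2 * \<alpha> * \<gamma> + 2 * \<beta> * \<gamma> + \<gamma>\<^sup>2))"
  have "narayana_ext (n + 56 * 2 ^ Suc i) = narayana_ext n + 2 ^ (Suc i + 4) *
        (\<alpha>' * narayana_ext n + \<beta>' * narayana_ext (n + 1) + \<gamma>' * narayana_ext (n + 2))" for n
  proof -
    let ?T = "56 * 2 ^ i"
    have e0: "narayana_ext (n + 56 * 2 ^ Suc i) = narayana_ext (n + ?T) + 16 * P *
        (\<alpha> * narayana_ext (n + ?T) + \<beta> * narayana_ext (n + 1 + ?T) + \<gamma> * narayana_ext (n + 2 + ?T))"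
      using eq[of "n + ?T"] by (simp add: pw ac_simps)
    have e3: "narayana_ext (n + 1 + 1) = narayana_ext (n + 2)"
      "narayana_ext (n + 1 + 2) = narayana_ext (n + 2) + narayana_ext n"
      "narayana_ext (n + 2 + 1) = narayana_ext (n + 2) + narayana_ext n"
      "narayana_ext (n + 2 + 2) = narayana_ext (n + 2) + narayana_ext (n + 1) + narayana_ext n"
      using narayana_ext_add3[of n] narayana_ext_add4[of n] by (simp_all add: add.assoc)
    show ?thesis
      unfolding e0 eq pw e3 \<alpha>'_def \<beta>'_def \<gamma>'_def by algebra
  qed
  moreover have "[\<alpha>' = 4] (mod 8)" "[\<beta>' = 5] (mod 8)" "[\<gamma>' = 7] (mod 8)"
    unfolding \<alpha>'_def \<beta>'_def \<gamma>'_def using m by (simp_all only: lift)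
  ultimately show ?case by blast
qed

section \<open>The power of 2 in a term\<close>

text \<open>A 2-adic derivative: 4, 5, 7 are the fixed residues of \<alpha>, \<beta>, \<gamma>
  modulo 8.\<close>

definition narayana_slope :: "nat \<Rightarrow> int" where
  "narayana_slope n = 4 * narayana_ext n + 5 * narayana_ext (n + 1) + 7 * narayana_ext (n + 2)"

text \<open>The slope is unchanged modulo 8 by each shift, so the u increments are equal modulo
  \<open>2 ^ (i + 7)\<close> and add up.\<close>

lemma narayana_ext_add_multiple:
  "[narayana_ext (n + 56 * 2 ^ i * u) = narayana_ext n + 2 ^ (i + 4) * int u * narayana_slope n]
     (mod 2 ^ (i + 7))"
proof (induction u arbitrary: n)
  case (Suc u)
  let ?T = "56 * 2 ^ i :: nat"
  obtain \<alpha> \<beta> \<gamma> :: int where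
    m: "[\<alpha> = 4] (mod 8)" "[\<beta> = 5] (mod 8)" "[\<gamma> = 7] (mod 8)" and
    eq: "\<And>n. narayana_ext (n + ?T) = narayana_ext n + 2 ^ (i + 4) *
        (\<alpha> * narayana_ext n + \<beta> * narayana_ext (n + 1) + \<gamma> * narayana_ext (n + 2))"
    using narayana_ext_add_pow2 by blast
  have scale: "[2 ^ (i + 4) * x = 2 ^ (i + 4) * y] (mod 2 ^ (i + 7))" if "[x = y] (mod 8)" for x y :: int
  proof -
    have "(2::int) ^ (i + 7) = 2 ^ (i + 4) * 8" by (simp add: power_add)
    thus ?thesis using that by (simp add: cong_def)
  qed
  have "[\<alpha> * narayana_ext n + \<beta> * narayana_ext (n + 1) + \<gamma> * narayana_ext (n + 2)
      = narayana_slope n] (mod 8)"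
    unfolding narayana_slope_def by (intro cong_add cong_mult m cong_refl)
  hence one: "[narayana_ext (n + ?T) = narayana_ext n + 2 ^ (i + 4) * narayana_slope n] (mod 2 ^ (i + 7))"
    unfolding eq by (intro cong_add cong_refl scale)
  have per: "[narayana_ext (k + ?T) = narayana_ext k] (mod 8)" for k
    unfolding eq cong_iff_dvd_diff by (simp add: power_add)
  have "[narayana_slope (n + ?T) = narayana_slope n] (mod 8)"
    unfolding narayana_slope_def using per[of n] per[of "n + 1"] per[of "n + 2"]
    by (intro cong_add cong_mult cong_refl) (simp_all add: ac_simps)
  hence slope: "[2 ^ (i + 4) * (int u * narayana_slope (n + ?T))
      = 2 ^ (i + 4) * (int u * narayana_slope n)] (mod 2 ^ (i + 7))"
    by (intro scale cong_mult cong_refl)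
  have "[narayana_ext (n + ?T + ?T * u)
      = narayana_ext (n + ?T) + 2 ^ (i + 4) * (int u * narayana_slope (n + ?T))] (mod 2 ^ (i + 7))"
    using Suc[of "n + ?T"] by (simp add: mult.assoc)
  also have "[narayana_ext (n + ?T) + 2 ^ (i + 4) * (int u * narayana_slope (n + ?T))
      = (narayana_ext n + 2 ^ (i + 4) * narayana_slope n) + 2 ^ (i + 4) * (int u * narayana_slope n)]
      (mod 2 ^ (i + 7))"
    by (intro cong_add one slope)
  finally show ?case by (simp add: algebra_simps)
qed simp

text \<open>At a zero only the slope term is left, and the slopes -3, 5, 7, 12 are not divisible by
  8. The value 12, a multiple of 4, is why precision modulo 8 is carried.\<close>

lemma narayana_ext_not_dvd:
  assumes "r \<in> {0, 5, 7, 8}" and "odd u"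
  shows "\<not> 2 ^ (i + 7) dvd narayana_ext (r + 56 * 2 ^ i * u)"
proof
  assume "2 ^ (i + 7) dvd narayana_ext (r + 56 * 2 ^ i * u)"
  moreover have "narayana_ext r = 0"
    using assms(1) by (auto simp: numeral_eq_Suc)
  ultimately have "2 ^ (i + 7) dvd 2 ^ (i + 4) * (int u * narayana_slope r)"
    using cong_dvd_iff[OF narayana_ext_add_multiple[of r i u]] by (simp add: cong_dvd_iff mult.assoc)
  moreover have "(2::int) ^ (i + 7) = 2 ^ (i + 4) * 8" by (simp add: power_add)
  ultimately have "2 ^ 3 dvd int u * narayana_slope r" by simp
  moreover have "coprime (2 ^ 3) (int u)"
    using assms(2) by (subst coprime_power_left_iff) simp
  ultimately have "8 dvd narayana_slope r"
    using coprime_dvd_mult_right_iff by fastforce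
  moreover have "narayana_slope r \<in> {-3, 5, 7, 12}"
    using assms(1) by (auto simp: narayana_slope_def numeral_eq_Suc)
  ultimately show False by auto
qed

lemma narayana_pow2_dvd_le:
  assumes "48 dvd narayana n" and "2 ^ k dvd narayana n" and "n > 0"
  shows "7 * 2 ^ k \<le> 8 * (n + 8)"
proof -
  let ?N = "n + 8"
  have "int 48 dvd int (narayana n)" "int (2 ^ k) dvd int (narayana n)"
    using assms(1,2) by (simp_all only: int_dvd_int_iff)
  hence d: "48 dvd narayana_ext ?N" "2 ^ k dvd narayana_ext ?N"
    by (simp_all add: narayana_ext_add8)
  define r where "r = ?N mod 56"
  define q where "q = ?N div 56"
  have r: "r \<in> {0, 5, 7, 8}"
    unfolding r_def using d(1) by (rule narayana_ext_dvd_48)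
  have N: "?N = r + 56 * q" by (simp add: r_def q_def)
  \<comment> \<open>For q = 0 the shifted index \<open>?N\<close> would be one of the zeros
    themselves, all at most 8.\<close>
  have "q > 0" using N r assms(3) by (intro Nat.gr0I) auto
  then obtain i u where iu: "q = 2 ^ i * u" "odd u"
    by (metis One_nat_def gr_implies_not0 multiplicity_decompose' nat_dvd_1_iff_1 numeral_eq_one_iff semiring_norm(85))
  have "\<not> 2 ^ (i + 7) dvd narayana_ext ?N"
    using narayana_ext_not_dvd[OF r iu(2), of i] by (simp add: N iu mult.assoc)
  hence "k < i + 7"
    using d(2) power_le_dvd by (metis not_le)
  hence "(2::nat) ^ k \<le> 2 ^ (i + 6)" by (intro power_increasing) auto
  also have "\<dots> \<le> 64 * q" using iu odd_pos[of u] by (simp add: power_add)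
  finally show ?thesis using N by simp
qed

section \<open>Growth of the sequence\<close>

lemma narayana_mono: "mono narayana"
proof -
  have "narayana n \<le> narayana (Suc n)" for n
    by (cases n rule: narayana.cases) auto
  thus ?thesis by (simp add: mono_iff_le_Suc)
qed

text \<open>By monotonicity the recurrence at least doubles the value every three steps.\<close>

lemma narayana_ge_pow2: "2 ^ j \<le> narayana (3 * j + 1)"
proof (induction j)
  case (Suc j)
  have "narayana (3 * Suc j + 1) = narayana (3 * j + 3) + narayana (3 * j + 1)"
    by (simp add: numeral_eq_Suc)
  moreover have "narayana (3 * j + 1) \<le> narayana (3 * j + 3)"
    by (rule monoD[OF narayana_mono]) simp
  ultimately show ?case using Suc by simp
qed simp

text \<open>Beyond this index the term is at least (2^m)^m, which exceeds m^m and hence m!.\<close>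

lemma narayana_fact_index_le:
  assumes "narayana n = fact m" and "m > 0"
  shows "n \<le> 3 * m\<^sup>2"
proof (rule ccontr)
  assume "\<not> n \<le> 3 * m\<^sup>2"
  hence "narayana (3 * m\<^sup>2 + 1) \<le> narayana n"
    by (intro monoD[OF narayana_mono]) simp
  hence "2 ^ m\<^sup>2 \<le> (fact m :: nat)"
    using narayana_ge_pow2[of "m\<^sup>2"] assms(1) by simp
  also have "\<dots> \<le> m ^ m" using fact_le_power[of m, where ?'a = nat] by simp
  also have "\<dots> < (2 ^ m) ^ m" using assms(2) by (intro power_strict_mono) auto
  finally show False by (simp add: power2_eq_square power_mult)
qed

section \<open>Comparison with factorials\<close>

text \<open>12! supplies 2^10, and each further block of four factors supplies 8: a multiple of 4
  and another even number.\<close>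

lemma pow2_dvd_fact: "2 ^ (10 + 3 * j) dvd (fact (12 + 4 * j) :: nat)"
proof (induction j)
  case 0
  show ?case by (simp add: fact_numeral)
next
  case (Suc j)
  define t where "t = 3 + j"
  have "(fact (s + 4) :: nat) = (s + 4) * ((s + 3) * ((s + 2) * ((s + 1) * fact s)))" for s
    by (simp add: numeral_eq_Suc)
  from this[of "12 + 4 * j"] have "(fact (12 + 4 * Suc j) :: nat)
      = (4 * t + 4) * ((4 * t + 3) * ((4 * t + 2) * ((4 * t + 1) * fact (12 + 4 * j))))"
    by (simp only: t_def) (simp add: add.commute)
  also have "\<dots> = 8 * ((t + 1) * (4 * t + 3) * (2 * t + 1) * (4 * t + 1)) * fact (12 + 4 * j)"
    by algebra
  finally have step: "8 * fact (12 + 4 * j) dvd (fact (12 + 4 * Suc j) :: nat)"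
    by (simp add: ac_simps)
  have "(2 ^ (10 + 3 * Suc j) :: nat) = 8 * 2 ^ (10 + 3 * j)"
    by (simp add: power_add)
  also have "\<dots> dvd 8 * fact (12 + 4 * j)"
    using Suc by (intro mult_dvd_mono dvd_refl)
  also note step
  finally show ?case .
qed

lemma narayana_fact_lt_12:
  assumes "narayana n = fact m" and "n > 0"
  shows "m < 12"
proof (rule ccontr)
  assume "\<not> m < 12"
  define j where "j = (m - 12) div 4"
  have m: "12 + 4 * j \<le> m" "m \<le> 15 + 4 * j"
    using \<open>\<not> m < 12\<close> by (auto simp: j_def)
  have "2 ^ (10 + 3 * j) dvd (fact m :: nat)"
    using pow2_dvd_fact fact_dvd[OF m(1)] dvd_trans by blast
  moreover have "48 dvd (fact m :: nat)"
    using fact_dvd[of 6 m, where ?'a = nat] m(1) by (auto simp: fact_numeral intro: dvd_trans[of 48 720])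
  ultimately have "7 * 2 ^ (10 + 3 * j) \<le> 8 * (n + 8)"
    using assms by (intro narayana_pow2_dvd_le) auto
  also have "\<dots> \<le> 24 * m\<^sup>2 + 64"
    using narayana_fact_index_le[OF assms(1)] m(1) by simp
  also have "\<dots> \<le> 24 * (15 + 4 * j)\<^sup>2 + 64"
    using power_mono[OF m(2), of 2] by simp
  \<comment> \<open>At j = 0 this reads 5464 < 7168; each step multiplies the right side by 8 and
    the left by at most 8.\<close>
  also have "\<dots> < 7 * 2 ^ (10 + 3 * j)"
  proof (induction j)
    case (Suc j)
    have "24 * (15 + 4 * Suc j)\<^sup>2 + 64 \<le> 8 * (24 * (15 + 4 * j)\<^sup>2 + 64)"
      by (simp add: power2_eq_square algebra_simps)
    also have "\<dots> < 8 * (7 * 2 ^ (10 + 3 * j))" using Suc by simp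
    finally show ?case by (simp add: power_add)
  qed simp
  finally show False by simp
qed

section \<open>The remaining finite check\<close>

lemma narayana_fact_small:
  assumes "narayana n = fact m" and "n > 0" and "m > 0" and "m < 12"
  shows "(n, m) \<in> {(1, 1), (2, 1), (3, 1), (4, 2), (7, 3)}"
proof -
  have T: "narayana_table 60 8 0 1 1 = map (\<lambda>i. (i, narayana_ext i)) [8..<68]"
    using narayana_table_eq[of 60 8] narayana_ext_add8[of 0] narayana_ext_add8[of 1] narayana_ext_add8[of 2]
    by (simp add: numeral_2_eq_2 del: upt_Suc)
  have F: "[(1, 1), (2, 2), (3, 6), (4, 24), (5, 120), (6, 720), (7, 5040), (8, 40320), (9, 362880),
      (10, 3628800), (11, 39916800)] = map (\<lambda>m. (m, fact m :: int)) [1..<12]"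
    by (simp add: fact_numeral upt_rec)
  \<comment> \<open>All indices are shifted by 8, so i > 8 means n > 0. The last entry, i = 67,
    exceeds 11! and by monotonicity disposes of all n from 59 on.\<close>
  have "list_all (\<lambda>(i, x). (i = 67 \<longrightarrow> x > 39916800) \<and>
      list_all (\<lambda>(m :: nat, f). i > 8 \<longrightarrow> x = f \<longrightarrow> (i, m) \<in> set [(9, 1), (10, 1), (11, 1), (12, 2), (15, 3)])
        [(1, 1), (2, 2), (3, 6), (4, 24), (5, 120), (6, 720), (7, 5040), (8, 40320), (9, 362880),
          (10, 3628800), (11, 39916800)])
      (narayana_table 60 8 0 1 1)"
    by code_simp
  hence *: "(i = 67 \<longrightarrow> narayana_ext i > 39916800) \<and> (\<forall>m\<in>{1..<12}. i > 8 \<longrightarrow> narayana_ext i = fact m \<longrightarrow>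
      (i, m) \<in> {(9, 1), (10, 1), (11, 1), (12, 2), (15, 3)})" if "i \<in> {8..<68}" for i
    unfolding T F using that
    by (simp only: list_all_iff set_map set_upt ball_simps prod.case list.set) blast
  have "n < 59"
  proof (rule ccontr)
    assume "\<not> n < 59"
    hence "narayana 59 \<le> narayana n" by (intro monoD[OF narayana_mono]) simp
    moreover have "int (narayana 59) > 39916800"
      using *[of 67] narayana_ext_add8[of 59] by simp
    moreover have "narayana n \<le> fact 11"
      unfolding assms(1) using assms(4) by (intro fact_mono_nat) simp
    ultimately show False by (simp add: fact_numeral)
  qed
  moreover have "narayana_ext (n + 8) = fact m"
    by (simp add: narayana_ext_add8 assms(1))
  ultimately show ?thesis
    using *[of "n + 8"] assms by auto
qed

theorem theorem2:
  "{(n :: nat, m :: nat). n > 0 \<and> m > 0 \<and> narayana n = fact m}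
     = {(1, 1), (2, 1), (3, 1), (4, 2), (7, 3)}"
proof (intro equalityI subrelI)
  fix n m :: nat
  assume "(n, m) \<in> {(n, m). n > 0 \<and> m > 0 \<and> narayana n = fact m}"
  hence nm: "n > 0" "m > 0" "narayana n = fact m" by simp_all
  from narayana_fact_lt_12[OF nm(3,1)] show "(n, m) \<in> {(1, 1), (2, 1), (3, 1), (4, 2), (7, 3)}"
    by (rule narayana_fact_small[OF nm(3,1,2)])
next
  fix n m :: nat
  assume "(n, m) \<in> {(1, 1), (2, 1), (3, 1), (4, 2), (7, 3)}"
  thus "(n, m) \<in> {(n, m). n > 0 \<and> m > 0 \<and> narayana n = fact m}"
    by (auto simp: numeral_eq_Suc)
qed

end
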